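(* Consider the sequential eigenvalue procedure with deflation for a Hermitian $R\in\mathbb{C}^{M\times M}$ and candidate space $\operatorname{span}(\mathcal{B})\subseteq\mathbb{C}^{M\times M}$. Suppose that at each accepted iteration $k$ the positive-overlap hypothesis $\max_{\sigma\in S_M}\langle A^\ast_{k+1},\mathbf{P}_\sigma\rangle_F>0$ holds. Then at every accepted iteration $|G_{k+1}|>|G_k|$.
   Context: $\mathbf{P}_\sigma$ is the permutation matrix of $\sigma\in S_M$; $\langle X,Y\rangle_F=\operatorname{Tr}(X^HY)$ (its real part is used when comparing overlaps); $\|\cdot\|_F$ is the Frobenius norm; $[X,Y]=XY-YX$; $\delta(A,R)=\|[R,A]\|_F/(\|R\|_F\|A\|_F)$. Procedure: initialize $G_0=\{e\}\le S_M$, $k=0$, with acceptance threshold $\tau\ge0$ and iteration cap $K_{\max}$. (S1) Form $\mathcal{B}^{\perp G_k}$, the Frobenius-orthogonal complement of $\operatorname{span}\{\mathbf{P}_g:g\in G_k\}$ within $\operatorname{span}(\mathcal{B})$ (the elements of $\operatorname{span}(\mathcal{B})$ orthogonal to every $\mathbf P_g$, $g\in G_k$). (S2) Let $A^\ast_{k+1}\in\mathcal{B}^{\perp G_k}$, $\|A^\ast_{k+1}\|_F=1$, be a minimizer of $\|[R,A]\|_F^2/\|A\|_F^2$ over nonzero $A\in\mathcal{B}^{\perp G_k}$. (S3) Let $\sigma^\ast_{k+1}\in\arg\max_{\sigma\in S_M}\langle A^\ast_{k+1},\mathbf{P}_\sigma\rangle_F$. (S4) If $\delta(\mathbf{P}_{\sigma^\ast_{k+1}},R)>\tau$,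 terminate and return $G_k$. (S5) Otherwise (iteration accepted) set $G_{k+1}=\langle G_k,\sigma^\ast_{k+1}\rangle$, increment $k$, and repeat unless $k\ge K_{\max}$. *)

theory Defs
  imports "HOL-Analysis.Analysis" "HOL-Algebra.Bij" "HOL-Algebra.Generated_Groups"
begin

text \<open>
  Complex \<open>M \<times> M\<close> matrices are \<open>complex^'n^'n\<close> with \<open>M = CARD('n)\<close>, and the symmetric group
  \<open>S\<^sub>M\<close> is \<open>BijGroup (UNIV :: 'n set)\<close>.
\<close>

definition cmat_scale :: "complex \<Rightarrow> complex^'n^'n \<Rightarrow> complex^'n^'n" where
  "cmat_scale c A = map_matrix ((*) c) A"

text \<open>The library's \<open>span\<close> on this type is the real span; \<open>cmat.span\<close> is the complex one.\<close>

interpretation cmat: vector_space cmat_scale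
  by unfold_locales (simp_all add: cmat_scale_def vec_eq_iff algebra_simps)

definition adjoint_mat :: "complex^'n^'n \<Rightarrow> complex^'n^'n" where
  "adjoint_mat A = map_matrix cnj (transpose A)"

definition hermitian :: "complex^'n^'n \<Rightarrow> bool" where
  "hermitian A \<longleftrightarrow> adjoint_mat A = A"

definition frob_inner :: "complex^'n^'n \<Rightarrow> complex^'n^'n \<Rightarrow> complex" where
  "frob_inner X Y = trace (adjoint_mat X ** Y)"

text \<open>The library \<open>norm\<close> on \<open>complex^'n^'n\<close> is the Frobenius norm.\<close>

lemma frob_inner_self: "frob_inner A A = complex_of_real ((norm A)\<^sup>2)"
proof -
  have "frob_inner A A = (\<Sum>i\<in>UNIV. \<Sum>k\<in>UNIV. complex_of_real ((norm (A $ k $ i))\<^sup>2))"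
    by (simp add: frob_inner_def adjoint_mat_def trace_def matrix_matrix_mult_def
        transpose_def complex_norm_square mult.commute del: of_real_power)
  also have "\<dots> = (\<Sum>k\<in>UNIV. \<Sum>i\<in>UNIV. complex_of_real ((norm (A $ k $ i))\<^sup>2))"
    by (rule sum.swap)
  also have "\<dots> = complex_of_real ((norm A)\<^sup>2)"
    by (simp add: norm_vec_def L2_set_def sum_nonneg)
  finally show ?thesis .
qed

definition commutator :: "complex^'n^'n \<Rightarrow> complex^'n^'n \<Rightarrow> complex^'n^'n" where
  "commutator X Y = X ** Y - Y ** X"

text \<open>With division by zero this is \<open>0\<close> when \<open>A\<close> or \<open>R\<close> is zero.\<close>

definition comm_defect :: "complex^'n^'n \<Rightarrow> complex^'n^'n \<Rightarrow> real" where
  "comm_defect A R = norm (commutator R A) / (norm R * norm A)"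

text \<open>Convention: column \<open>j\<close> of the matrix is the unit vector at \<open>\<sigma> j\<close>.\<close>

definition perm_matrix :: "('n \<Rightarrow> 'n) \<Rightarrow> complex^'n^'n" where
  "perm_matrix \<sigma> = (\<chi> i j. if i = \<sigma> j then 1 else 0)"

definition overlap :: "complex^'n^'n \<Rightarrow> ('n \<Rightarrow> 'n) \<Rightarrow> real" where
  "overlap A \<sigma> = Re (frob_inner A (perm_matrix \<sigma>))"

definition deflated_space ::
    "(complex^'n^'n) set \<Rightarrow> ('n \<Rightarrow> 'n) set \<Rightarrow> (complex^'n^'n) set" where
  "deflated_space B G = {A \<in> cmat.span B. \<forall>g\<in>G. frob_inner (perm_matrix g) A = 0}"

definition is_deflated_minimizer ::
    "complex^'n^'n \<Rightarrow> (complex^'n^'n) set \<Rightarrow> ('n \<Rightarrow> 'n) set \<Rightarrow> complex^'n^'n \<Rightarrow> bool" where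
  "is_deflated_minimizer R B G A \<longleftrightarrow>
     norm A = 1 \<and>
     is_arg_min (\<lambda>X. (norm (commutator R X))\<^sup>2 / (norm X)\<^sup>2)
       (\<lambda>X. X \<in> deflated_space B G \<and> X \<noteq> 0) A"

text \<open>
  The first \<open>N\<close> iterations of an execution, all of them accepted; the choices of minimizer and of
  permutation are arbitrary, so they are part of the data. The cap is only tested after an
  accepted iteration, so iteration \<open>0\<close> is always attempted and iteration \<open>k > 0\<close> only
  if \<open>k < Kmax\<close>.
\<close>

definition deflation_run ::
    "complex^'n^'n \<Rightarrow> (complex^'n^'n) set \<Rightarrow> real \<Rightarrow> nat \<Rightarrow> nat \<Rightarrow>
     (nat \<Rightarrow> ('n \<Rightarrow> 'n) set) \<Rightarrow> (nat \<Rightarrow> complex^'n^'n) \<Rightarrow> (nat \<Rightarrow> 'n \<Rightarrow> 'n) \<Rightarrow> bool" where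
  "deflation_run R B \<tau> Kmax N G A \<sigma> \<longleftrightarrow>
     G 0 = {\<one>\<^bsub>BijGroup UNIV\<^esub>} \<and>
     (\<forall>k<N.
        (k = 0 \<or> k < Kmax) \<and>
        is_deflated_minimizer R B (G k) (A (Suc k)) \<and>
        is_arg_max (overlap (A (Suc k))) (\<lambda>\<pi>. \<pi> \<in> carrier (BijGroup UNIV)) (\<sigma> (Suc k)) \<and>
        comm_defect (perm_matrix (\<sigma> (Suc k))) R \<le> \<tau> \<and>
        G (Suc k) = generate (BijGroup UNIV) (insert (\<sigma> (Suc k)) (G k)))"

end

theory Submission
  imports Defs
begin

text \<open>Deflation makes \<open>A (Suc k)\<close> orthogonal to the permutation matrix of every
  element of \<open>G k\<close>, so all overlaps on \<open>G k\<close> vanish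
  (\<open>overlap_deflated_eq_0\<close>). A maximizer over all permutations has positive overlap by
  hypothesis, hence lies outside \<open>G k\<close>, and adjoining it to the generators enlarges the
  group strictly.\<close>

lemma frob_inner_commute: "frob_inner Y X = cnj (frob_inner X Y)"
  by (simp add: frob_inner_def adjoint_mat_def trace_def matrix_matrix_mult_def
      transpose_def mult.commute)

text \<open>\<open>deflated_space\<close> has the permutation matrix in the first slot of
  \<open>frob_inner\<close>, \<open>overlap\<close> in the second; conjugate symmetry carries the
  zero across.\<close>

lemma overlap_deflated_eq_0:
  assumes "A \<in> deflated_space B G" and "g \<in> G"
  shows "overlap A g = 0"
  using assms by (simp add: deflated_space_def overlap_def frob_inner_commute[of A])

theorem theorem11p3:
  fixes R :: "complex^'n^'n" and B :: "(complex^'n^'n) set"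
    and \<tau> :: real and Kmax N :: nat
    and G :: "nat \<Rightarrow> ('n \<Rightarrow> 'n) set"
    and A :: "nat \<Rightarrow> complex^'n^'n"
    and \<sigma> :: "nat \<Rightarrow> 'n \<Rightarrow> 'n"
  assumes "hermitian R" and "\<tau> \<ge> 0"
    and "deflation_run R B \<tau> Kmax N G A \<sigma>"
    and "\<forall>k<N. Max (overlap (A (Suc k)) ` carrier (BijGroup UNIV)) > 0"
  shows "\<forall>k<N. card (G (Suc k)) > card (G k)"
proof (intro allI impI)
  fix k assume k: "k < N"
  let ?S = "carrier (BijGroup (UNIV :: 'n set))"
  have minimizer: "is_deflated_minimizer R B (G k) (A (Suc k))"
    and argmax: "is_arg_max (overlap (A (Suc k))) (\<lambda>\<pi>. \<pi> \<in> ?S) (\<sigma> (Suc k))"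
    and step: "G (Suc k) = generate (BijGroup UNIV) (insert (\<sigma> (Suc k)) (G k))"
    using assms(3) k by (auto simp: deflation_run_def)
  have deflated: "A (Suc k) \<in> deflated_space B (G k)"
    using minimizer by (simp add: is_deflated_minimizer_def is_arg_min_def)
  have "\<sigma> (Suc k) \<in> ?S"
    using argmax by (simp add: is_arg_max_def)
  \<comment> \<open>The membership just shown makes the set under \<open>Max\<close> nonempty; it is
    finite because \<open>'n\<close> is.\<close>
  then have "\<exists>\<pi>\<in>?S. overlap (A (Suc k)) \<pi> > 0"
    using assms(4) k by (subst (asm) Max_gr_iff) auto
  then have "overlap (A (Suc k)) (\<sigma> (Suc k)) > 0"
    using argmax by (force simp: is_arg_max_linorder)
  then have "\<sigma> (Suc k) \<notin> G k"
    using overlap_deflated_eq_0[OF deflated] by force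
  moreover have "insert (\<sigma> (Suc k)) (G k) \<subseteq> G (Suc k)"
    unfolding step by (auto intro: generate.incl)
  ultimately have "G k \<subset> G (Suc k)"
    by blast
  then show "card (G (Suc k)) > card (G k)"
    \<comment> \<open>Strict growth of \<open>card\<close> needs \<open>G (Suc k)\<close> finite: it
      consists of self-maps of the finite type \<open>'n\<close>.\<close>
    by (intro psubset_card_mono) auto
qed

end
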